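(* Let $0\le k\le K$ be integers and let $\mathcal{T}=\mathcal{T}_{K+1,k+1}$ be the $(K+1,k+1)$-biregular tree, with vertex set $L_{\mathcal{T}}\sqcup R_{\mathcal{T}}$ (vertices in $L_{\mathcal{T}}$ have degree $K+1$, vertices in $R_{\mathcal{T}}$ have degree $k+1$). Let $\Lambda$ be a group acting on $\mathcal{T}$ by graph automorphisms such that the action is simply transitive on $L_{\mathcal{T}}$. Fix $v_0\in L_{\mathcal{T}}$ and let $v_1,\dots,v_{K+1}\in R_{\mathcal{T}}$ be its neighbors. For $i\in\{1,\dots,K+1\}$ put $$S^i=\{1\neq s\in\Lambda \mid \mathrm{dist}(sv_0,v_i)=1\}.$$ Then $(\Lambda,(S^1,\dots,S^{K+1}))$ satisfies the bi-Cayley axioms, and the Cayley bigraph $CayB(\Lambda,(S^i)_i)=(L\sqcup R,E)$ is isomorphic to $\mathcal{T}$ via the map $f$ given by $f(g)=gv_0$ for $g\in L=\Lambda$ and $f([g,i])=gv_i$ for $[g,i]\in R$.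
   Context: Let $G$ be a group and $S^1,\dots,S^{K+1}\subseteq G$ pairwise disjoint subsets each of size $k$; put $S=\bigsqcup_i S^i$ and define $i:S\to\{1,\dots,K+1\}$ by $s\in S^{i(s)}$. The pair $(G,(S^i))$ satisfies the bi-Cayley axioms if (1) $S=S^{-1}$ and $1\notin S$, and (2) whenever $s,t\in S^i$, either $s=t$ or $s^{-1}t\in S^{i(s^{-1})}$. In that case define a relation on $G\times\{1,\dots,K+1\}$ by $(g_1,j_1)\sim(g_2,j_2)$ iff either $(g_1,j_1)=(g_2,j_2)$, or $g_1^{-1}g_2\in S^{j_1}$ and $g_2^{-1}g_1\in S^{j_2}$; it is an equivalence relation, and $[g,j]$ denotes the class of $(g,j)$. The Cayley bigraph $CayB(G,(S^i))$ is the bipartite graph with left vertices $L=G$, right vertices $R=(G\times\{1,\dots,K+1\})/\sim$, and edges $\{g,[g,i]\}$ for $g\in G$, $i\in\{1,\dots,K+1\}$. *)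

theory Defs
  imports "Graph_Theory.Graph_Theory" "HOL-Algebra.Group_Action"
begin

section \<open>Undirected graphs, trees and isomorphisms\<close>

text \<open>
  A (possibly infinite) simple undirected graph is a loop-free symmetric
  \<^typ>\<open>'a pair_pre_digraph\<close>, i.e. one satisfying \<^locale>\<open>pair_bidirected_digraph\<close>: the edge
  \<open>{u, v}\<close> is represented by the two arcs \<open>(u, v)\<close> and \<open>(v, u)\<close>.
  The library predicate \<^const>\<open>tree\<close> excludes all directed cycles, hence also the closed walk
  \<open>u, v, u\<close> that every edge of such a graph gives rise to. A cycle of the undirected
  graph is a directed cycle of length at least 3.
\<close>

definition undirected_tree :: "'v pair_pre_digraph \<Rightarrow> bool" where
  "undirected_tree T \<longleftrightarrow>
     pair_bidirected_digraph T \<and>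
     Digraph_Component.connected (with_proj T) \<and>
     \<not> (\<exists>p. pre_digraph.cycle (with_proj T) p \<and> 3 \<le> length p)"

definition biregular_tree ::
    "nat \<Rightarrow> nat \<Rightarrow> 'v set \<Rightarrow> 'v set \<Rightarrow> 'v pair_pre_digraph \<Rightarrow> bool" where
  "biregular_tree a b L R T \<longleftrightarrow>
     undirected_tree T \<and>
     pverts T = L \<union> R \<and> L \<inter> R = {} \<and>
     parcs T \<subseteq> L \<times> R \<union> R \<times> L \<and>
     (\<forall>x\<in>L. finite (out_arcs (with_proj T) x) \<and> out_degree (with_proj T) x = a) \<and>
     (\<forall>y\<in>R. finite (out_arcs (with_proj T) y) \<and> out_degree (with_proj T) y = b)"

text \<open>\<^const>\<open>wf_digraph.\<mu>\<close> is the infimum of the costs of all walks; all arcs have cost 1.\<close>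

definition graph_dist :: "'v pair_pre_digraph \<Rightarrow> 'v \<Rightarrow> 'v \<Rightarrow> ereal" where
  "graph_dist T u v = wf_digraph.\<mu> (with_proj T) (\<lambda>_. 1) u v"

definition graph_isomorphism ::
    "('v \<Rightarrow> 'w) \<Rightarrow> 'v pair_pre_digraph \<Rightarrow> 'w pair_pre_digraph \<Rightarrow> bool" where
  "graph_isomorphism f X Y \<longleftrightarrow>
     (let h = \<lparr> iso_verts = f, iso_arcs = map_prod f f, iso_head = snd, iso_tail = fst \<rparr>
      in pre_digraph.digraph_isomorphism (with_proj X) h \<and> with_proj Y = app_iso h (with_proj X))"

lemma graph_isomorphism_iff:
  assumes "pair_wf_digraph X" "pair_wf_digraph Y"
  shows "graph_isomorphism f X Y \<longleftrightarrow>
    bij_betw f (pverts X) (pverts Y) \<and>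
    (\<forall>u\<in>pverts X. \<forall>v\<in>pverts X. (u, v) \<in> parcs X \<longleftrightarrow> (f u, f v) \<in> parcs Y)"
proof -
  interpret X: pair_wf_digraph X by fact
  interpret Y: pair_wf_digraph Y by fact
  have iff: "graph_isomorphism f X Y \<longleftrightarrow>
      inj_on f (pverts X) \<and> inj_on (map_prod f f) (parcs X) \<and>
      pverts Y = f ` pverts X \<and> parcs Y = map_prod f f ` parcs X"
    using X.wf_digraph
    by (auto simp: graph_isomorphism_def Let_def pre_digraph.digraph_isomorphism_def
        app_iso_def with_proj_def)
  have sub: "parcs X \<subseteq> pverts X \<times> pverts X" "parcs Y \<subseteq> pverts Y \<times> pverts Y"
    using X.wellformed' Y.wellformed' by auto
  show ?thesis
  proof
    assume "graph_isomorphism f X Y"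
    then have i: "inj_on f (pverts X)" and v: "pverts Y = f ` pverts X"
      and a: "parcs Y = map_prod f f ` parcs X"
      using iff by auto
    have "(u, w) \<in> parcs X"
      if "u \<in> pverts X" "w \<in> pverts X" "(f u, f w) \<in> parcs Y" for u w
    proof -
      from that(3) a obtain u' w' where *: "(u', w') \<in> parcs X" "f u' = f u" "f w' = f w"
        by auto
      then have "u' = u" "w' = w"
        using i that(1,2) sub(1) by (auto dest: inj_onD)
      with * show ?thesis by simp
    qed
    moreover have "(f u, f w) \<in> parcs Y" if "(u, w) \<in> parcs X" for u w
      using that a by (auto intro: rev_image_eqI)
    ultimately show "bij_betw f (pverts X) (pverts Y) \<and>
      (\<forall>u\<in>pverts X. \<forall>v\<in>pverts X. (u, v) \<in> parcs X \<longleftrightarrow> (f u, f v) \<in> parcs Y)"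
      using i v unfolding bij_betw_def by blast
  next
    assume r: "bij_betw f (pverts X) (pverts Y) \<and>
      (\<forall>u\<in>pverts X. \<forall>v\<in>pverts X. (u, v) \<in> parcs X \<longleftrightarrow> (f u, f v) \<in> parcs Y)"
    then have i: "inj_on f (pverts X)" and v: "pverts Y = f ` pverts X"
      by (auto simp: bij_betw_def)
    have "inj_on (map_prod f f) (parcs X)"
      using map_prod_inj_on[OF i i] sub(1) by (rule inj_on_subset)
    moreover have "parcs Y = map_prod f f ` parcs X"
    proof
      show "parcs Y \<subseteq> map_prod f f ` parcs X"
      proof
        fix e assume e: "e \<in> parcs Y"
        then obtain u w where "e = (f u, f w)" "u \<in> pverts X" "w \<in> pverts X"
          using sub(2) v by (cases e) auto
        with e r show "e \<in> map_prod f f ` parcs X" by (auto intro: rev_image_eqI)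
      qed
      show "map_prod f f ` parcs X \<subseteq> parcs Y" using r sub(1) by auto
    qed
    ultimately show "graph_isomorphism f X Y" using iff i v by blast
  qed
qed

section \<open>Group actions on graphs\<close>

definition graph_action ::
    "('g, 'm) monoid_scheme \<Rightarrow> 'v pair_pre_digraph \<Rightarrow> ('g \<Rightarrow> 'v \<Rightarrow> 'v) \<Rightarrow> bool" where
  "graph_action G T \<phi> \<longleftrightarrow>
     group_action G (pverts T) \<phi> \<and> (\<forall>g\<in>carrier G. graph_isomorphism (\<phi> g) T T)"

text \<open>Simple transitivity on a subset of the vertices includes its invariance.\<close>

definition simply_transitive_on ::
    "('g, 'm) monoid_scheme \<Rightarrow> ('g \<Rightarrow> 'v \<Rightarrow> 'v) \<Rightarrow> 'v set \<Rightarrow> bool" where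
  "simply_transitive_on G \<phi> L \<longleftrightarrow>
     (\<forall>g\<in>carrier G. \<phi> g ` L = L) \<and>
     (\<forall>x\<in>L. \<forall>y\<in>L. \<exists>!g. g \<in> carrier G \<and> \<phi> g x = y)"

section \<open>Cayley bigraphs\<close>

text \<open>
  Families \<open>S\<close> are indexed by \<open>{1..K+1}\<close>; their values elsewhere are irrelevant.
  For disjoint blocks, \<open>block_index K S s\<close> is the unique \<open>i\<close> with \<open>s \<in> S i\<close>.
\<close>

definition block_index :: "nat \<Rightarrow> (nat \<Rightarrow> 'g set) \<Rightarrow> 'g \<Rightarrow> nat" where
  "block_index K S s = (THE i. i \<in> {1..K+1} \<and> s \<in> S i)"

definition bi_cayley ::
    "('g, 'm) monoid_scheme \<Rightarrow> nat \<Rightarrow> nat \<Rightarrow> (nat \<Rightarrow> 'g set) \<Rightarrow> bool" where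
  "bi_cayley G K k S \<longleftrightarrow>
     group G \<and>
     (\<forall>i\<in>{1..K+1}. S i \<subseteq> carrier G \<and> finite (S i) \<and> card (S i) = k) \<and>
     disjoint_family_on S {1..K+1} \<and>
     (let U = (\<Union>i\<in>{1..K+1}. S i)
      in (\<lambda>s. inv\<^bsub>G\<^esub> s) ` U = U \<and> \<one>\<^bsub>G\<^esub> \<notin> U) \<and>
     (\<forall>i\<in>{1..K+1}. \<forall>s\<in>S i. \<forall>t\<in>S i.
        s = t \<or> inv\<^bsub>G\<^esub> s \<otimes>\<^bsub>G\<^esub> t \<in> S (block_index K S (inv\<^bsub>G\<^esub> s)))"

definition cayb_rel ::
    "('g, 'm) monoid_scheme \<Rightarrow> nat \<Rightarrow> (nat \<Rightarrow> 'g set) \<Rightarrow> (('g \<times> nat) \<times> ('g \<times> nat)) set" where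
  "cayb_rel G K S =
     {((g1, j1), (g2, j2)). (g1, j1) \<in> carrier G \<times> {1..K+1} \<and> (g2, j2) \<in> carrier G \<times> {1..K+1} \<and>
        ((g1, j1) = (g2, j2) \<or>
         inv\<^bsub>G\<^esub> g1 \<otimes>\<^bsub>G\<^esub> g2 \<in> S j1 \<and> inv\<^bsub>G\<^esub> g2 \<otimes>\<^bsub>G\<^esub> g1 \<in> S j2)}"

definition cayb_class ::
    "('g, 'm) monoid_scheme \<Rightarrow> nat \<Rightarrow> (nat \<Rightarrow> 'g set) \<Rightarrow> 'g \<Rightarrow> nat \<Rightarrow> ('g \<times> nat) set" where
  "cayb_class G K S g i = cayb_rel G K S `` {(g, i)}"

definition CayB ::
    "('g, 'm) monoid_scheme \<Rightarrow> nat \<Rightarrow> (nat \<Rightarrow> 'g set) \<Rightarrow> ('g + ('g \<times> nat) set) pair_pre_digraph" where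
  "CayB G K S =
     \<lparr> pverts = Inl ` carrier G \<union> Inr ` ((carrier G \<times> {1..K+1}) // cayb_rel G K S),
       parcs = (\<Union>g\<in>carrier G. \<Union>i\<in>{1..K+1}.
         {(Inl g, Inr (cayb_class G K S g i)), (Inr (cayb_class G K S g i), Inl g)}) \<rparr>"

lemma equiv_cayb_rel:
  fixes G (structure)
  assumes B: "bi_cayley G K k S"
  shows "equiv (carrier G \<times> {1..K+1}) (cayb_rel G K S)"
proof (rule equivI)
  interpret group G using B by (simp add: bi_cayley_def)
  have index_unique: "i = j"
    if "s \<in> S i" "s \<in> S j" "i \<in> {1..K+1}" "j \<in> {1..K+1}" for s i j
  proof -
    have "disjoint_family_on S {1..K+1}" using B by (simp add: bi_cayley_def)
    then show ?thesis using that unfolding disjoint_family_on_def by blast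
  qed
  have index_eq: "block_index K S s = i" if "s \<in> S i" "i \<in> {1..K+1}" for s i
    unfolding block_index_def using that index_unique by blast
  have ax2: "inv s \<otimes> t \<in> S (block_index K S (inv s))"
    if "i \<in> {1..K+1}" "s \<in> S i" "t \<in> S i" "s \<noteq> t" for i s t
    using B that unfolding bi_cayley_def by blast
  show "cayb_rel G K S \<subseteq> (carrier G \<times> {1..K+1}) \<times> (carrier G \<times> {1..K+1})"
    by (auto simp: cayb_rel_def)
  show "refl_on (carrier G \<times> {1..K+1}) (cayb_rel G K S)"
    by (auto simp: refl_on_def cayb_rel_def)
  show "sym (cayb_rel G K S)"
    by (auto simp: sym_def cayb_rel_def)
  have quot: "inv (inv a \<otimes> b) = inv b \<otimes> a" "inv a \<otimes> b \<otimes> (inv b \<otimes> c) = inv a \<otimes> c"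
    if "a \<in> carrier G" "b \<in> carrier G" "c \<in> carrier G" for a b c
  proof -
    show "inv (inv a \<otimes> b) = inv b \<otimes> a" using that by (simp add: inv_mult_group)
    have "b \<otimes> (inv b \<otimes> c) = c" using that by (simp add: m_assoc[symmetric])
    then show "inv a \<otimes> b \<otimes> (inv b \<otimes> c) = inv a \<otimes> c" using that by (simp add: m_assoc)
  qed
  have step: "inv a \<otimes> c \<in> S i"
    if "a \<in> carrier G" "b \<in> carrier G" "c \<in> carrier G" "a \<noteq> c"
      and "i \<in> {1..K+1}" "j \<in> {1..K+1}"
      and "inv a \<otimes> b \<in> S i" "inv b \<otimes> a \<in> S j" "inv b \<otimes> c \<in> S j" for a b c i j
    using ax2[of j "inv b \<otimes> a" "inv b \<otimes> c"] index_eq[of "inv a \<otimes> b" i] that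
    by (simp add: quot)
  show "trans (cayb_rel G K S)"
  proof (rule transI)
    fix x y z assume xy: "(x, y) \<in> cayb_rel G K S" and yz: "(y, z) \<in> cayb_rel G K S"
    obtain a i b j c l where e: "x = (a, i)" "y = (b, j)" "z = (c, l)"
      by (cases x, cases y, cases z) auto
    show "(x, z) \<in> cayb_rel G K S"
    proof (cases "x = y \<or> y = z")
      case True
      with xy yz show ?thesis by auto
    next
      case False
      with xy yz e have *: "a \<in> carrier G" "b \<in> carrier G" "c \<in> carrier G"
        "i \<in> {1..K+1}" "j \<in> {1..K+1}" "l \<in> {1..K+1}"
        "inv a \<otimes> b \<in> S i" "inv b \<otimes> a \<in> S j" "inv b \<otimes> c \<in> S j" "inv c \<otimes> b \<in> S l"
        by (auto simp: cayb_rel_def)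
      show ?thesis
      proof (cases "a = c")
        case True
        with * have "i = l" using index_unique by blast
        with True * e show ?thesis by (simp add: cayb_rel_def)
      next
        case False
        with * step[of a b c i j] step[of c b a l j] e show ?thesis
          by (simp add: cayb_rel_def)
      qed
    qed
  qed
qed

end

theory Submission
  imports Defs
begin

text \<open>
  Simple transitivity identifies \<open>g\<close> with the left vertex \<open>g v\<^sub>0\<close>, so that \<open>S i\<close> consists of the
  neighbours of \<open>v i\<close> other than \<open>v\<^sub>0\<close>. Of the tree only the absence of 4-cycles matters: two distinct
  left vertices have at most one common neighbour. If \<open>s \<in> S i\<close>, then \<open>s\<inverse> v i\<close> is a neighbour of both
  \<open>v\<^sub>0\<close> and \<open>s\<inverse> v\<^sub>0\<close>, hence it equals \<open>v j\<close> for the index \<open>j\<close> with \<open>s\<inverse> \<in> S j\<close>. This yields both axioms,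
  and shows that \<open>(g, i)\<close> and \<open>(h, j)\<close> are equivalent iff \<open>g v i = h v j\<close>.
\<close>

section \<open>Distances and short cycles\<close>

text \<open>With unit costs a walk costs its length, so the distance is an infimum of lengths.
  Distinct ends exclude the empty walk, hence the value 1 amounts to a walk along a single
  arc.\<close>

lemma graph_dist_eq_1_iff:
  assumes T: "pair_wf_digraph T" and "x \<noteq> y"
  shows "graph_dist T x y = 1 \<longleftrightarrow> (x, y) \<in> parcs T"
proof -
  interpret pair_wf_digraph T by fact
  have cost: "awalk_cost (\<lambda>_. 1) p = real (length p)" for p :: "('a \<times> 'a) list"
    by (induct p) auto
  have dist: "graph_dist T x y = (INF p\<in>{p. awalk x p y}. ereal (real (length p)))"
    unfolding graph_dist_def \<mu>_def cost ..
  have ge: "1 \<le> length p" if "awalk x p y" for p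
    using that \<open>x \<noteq> y\<close> by (cases p) (auto simp: awalk_def)
  show ?thesis
  proof
    assume "graph_dist T x y = 1"
    \<comment> \<open>The bound 2 turns the infimum into an actual walk: some length lies strictly
      below 2, and none is 0.\<close>
    then have "(INF p\<in>{p. awalk x p y}. ereal (real (length p))) < ereal 2"
      unfolding dist by simp
    then obtain p where p: "awalk x p y" and "ereal (real (length p)) < ereal 2"
      by (auto simp only: INF_less_iff mem_Collect_eq)
    then have "length p = 1" using ge[OF p] by simp
    then obtain e where "p = [e]" by (auto simp: length_Suc_conv)
    with p show "(x, y) \<in> parcs T" by (cases e) (auto simp: awalk_def)
  next
    assume "(x, y) \<in> parcs T"
    then have walk: "awalk x [(x, y)] y"
      by (auto simp: awalk_def dest: in_arcsD1)
    show "graph_dist T x y = 1"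
    proof (rule antisym)
      show "graph_dist T x y \<le> 1"
        unfolding dist by (rule INF_lower2[of "[(x, y)]"]) (use walk in auto)
      show "1 \<le> graph_dist T x y"
        unfolding dist by (rule INF_greatest) (use ge in auto)
    qed
  qed
qed

text \<open>Otherwise \<open>x\<close>, \<open>y\<close>, \<open>x'\<close>, \<open>y'\<close> would
  be the vertices of a directed cycle with four arcs, and \<open>undirected_tree\<close> forbids
  cycles of length at least 3.\<close>

lemma undirected_tree_no_4_cycle:
  assumes T: "undirected_tree T"
    and arcs: "(x, y) \<in> parcs T" "(x, y') \<in> parcs T" "(x', y) \<in> parcs T" "(x', y') \<in> parcs T"
    and "x \<noteq> x'"
  shows "y = y'"
proof (rule ccontr)
  assume "y \<noteq> y'"
  interpret pair_bidirected_digraph T using T by (simp add: undirected_tree_def)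
  have sym: "(b, a) \<in> parcs T" if "(a, b) \<in> parcs T" for a b
    using pair_sym_arcs that by (auto simp: symmetric_def dest: symD)
  \<comment> \<open>Absence of loops separates consecutive vertices of the cycle; the two assumed
    inequalities separate opposite ones.\<close>
  have neq: "a \<noteq> b" if "(a, b) \<in> parcs T" for a b
    using pair_no_loops[OF that] by simp
  have "cycle [(x, y), (y, x'), (x', y'), (y', x)]"
    unfolding cycle_def
    by (rule exI[of _ x])
      (use arcs \<open>x \<noteq> x'\<close> \<open>y \<noteq> y'\<close> in \<open>auto simp: awalk_def dest: in_arcsD1 sym neq\<close>)
  then show False using T unfolding undirected_tree_def by fastforce
qed

section \<open>Simply transitive actions on bipartite graphs without 4-cycles\<close>

text \<open>The graph enters as a bare arc relation \<open>A\<close> with both directions of each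
  edge, so that neighbourhoods are relational images. Acyclicity survives as
  \<open>no_4_cycle\<close>, the degree \<open>K + 1\<close> of \<open>v0\<close> as the bijection
  \<open>neighbours\<close>, and distance 1 as an arc in \<open>S_def\<close>.\<close>

locale simply_transitive_bigraph = group_action G E \<phi>
  for G :: "('g, 'm) monoid_scheme" (structure) and E :: "'v set" and \<phi> +
  fixes A :: "'v rel" and L R :: "'v set"
    and K k :: nat and v0 :: 'v and v :: "nat \<Rightarrow> 'v" and S :: "nat \<Rightarrow> 'g set"
  assumes vertices: "E = L \<union> R" and disjoint: "L \<inter> R = {}"
    and bipartite: "A \<subseteq> L \<times> R \<union> R \<times> L"
    and sym_arcs: "(x, y) \<in> A \<Longrightarrow> (y, x) \<in> A"
    and no_4_cycle: "(x, y) \<in> A \<Longrightarrow> (x, y') \<in> A \<Longrightarrow> (x', y) \<in> A \<Longrightarrow> (x', y') \<in> A \<Longrightarrow> x \<noteq> x' \<Longrightarrow> y = y'"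
    and right_degree: "y \<in> R \<Longrightarrow> finite (A `` {y}) \<and> card (A `` {y}) = k + 1"
    and arc_image: "g \<in> carrier G \<Longrightarrow> (x, y) \<in> A \<Longrightarrow> (\<phi> g x, \<phi> g y) \<in> A"
    and transitive: "simply_transitive_on G \<phi> L"
    and base: "v0 \<in> L"
    and neighbours: "bij_betw v {1..K+1} (A `` {v0})"
    and S_def: "i \<in> {1..K+1} \<Longrightarrow> S i = {s \<in> carrier G. s \<noteq> \<one> \<and> (\<phi> s v0, v i) \<in> A}"
begin

section \<open>The action and the orbit of left vertices\<close>

sublocale group G by (rule group_hom.axioms(1)[OF group_hom])

lemma act_one: "x \<in> E \<Longrightarrow> \<phi> \<one> x = x"
  using id_eq_one by (metis restrict_apply')

lemma act_mult: "g \<in> carrier G \<Longrightarrow> h \<in> carrier G \<Longrightarrow> x \<in> E \<Longrightarrow> \<phi> (g \<otimes> h) x = \<phi> g (\<phi> h x)"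
  using composition_rule by simp

lemma act_inv: "g \<in> carrier G \<Longrightarrow> x \<in> E \<Longrightarrow> \<phi> (inv g) (\<phi> g x) = x"
  by (metis act_mult act_one inv_closed l_inv)

lemma act_eq_iff:
  assumes "g \<in> carrier G" "h \<in> carrier G" "x \<in> E" "y \<in> E"
  shows "\<phi> g x = \<phi> h y \<longleftrightarrow> \<phi> (inv g \<otimes> h) y = x"
  using assms by (metis act_inv act_mult inv_closed inv_inv element_image)

lemma left_image: "g \<in> carrier G \<Longrightarrow> x \<in> L \<Longrightarrow> \<phi> g x \<in> L"
  using transitive unfolding simply_transitive_on_def by blast

lemma left_orbit:
  assumes "x \<in> L"
  obtains g where "g \<in> carrier G" "x = \<phi> g v0"
  using transitive base assms unfolding simply_transitive_on_def by metis

text \<open>The uniqueness half of simple transitivity, for the vertices \<open>v0\<close> and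
  \<open>\<phi> h v0\<close>; it lets group elements stand for left vertices.\<close>

lemma left_inj: "g \<in> carrier G \<Longrightarrow> h \<in> carrier G \<Longrightarrow> \<phi> g v0 = \<phi> h v0 \<Longrightarrow> g = h"
  using transitive base left_image[of h v0] unfolding simply_transitive_on_def by metis

section \<open>Neighbours of the base vertex and their translates\<close>

lemma v0_in [simp]: "v0 \<in> E"
  using base vertices by simp

lemma v_arc: "i \<in> {1..K+1} \<Longrightarrow> (v0, v i) \<in> A"
  using bij_betw_apply[OF neighbours] by simp

lemma v_right: "i \<in> {1..K+1} \<Longrightarrow> v i \<in> R"
  using v_arc bipartite base disjoint by blast

lemma v_in: "i \<in> {1..K+1} \<Longrightarrow> v i \<in> E"
  using v_right vertices by simp

lemma v_inj: "i \<in> {1..K+1} \<Longrightarrow> j \<in> {1..K+1} \<Longrightarrow> v i = v j \<Longrightarrow> i = j"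
  using bij_betw_imp_inj_on[OF neighbours] by (simp add: inj_on_eq_iff)

lemma neighbour_obtain:
  assumes "(v0, y) \<in> A"
  obtains i where "i \<in> {1..K+1}" "y = v i"
  using assms neighbours unfolding bij_betw_def by (metis Image_singleton_iff imageE)

lemma right_image:
  assumes "g \<in> carrier G" "i \<in> {1..K+1}"
  shows "\<phi> g (v i) \<in> R"
  using arc_image[OF assms(1) v_arc[OF assms(2)]] bipartite left_image[OF assms(1) base] disjoint
  by blast

text \<open>Translation by \<open>inv g\<close> moves the arc to one starting at \<open>v0\<close>,
  whose neighbours are the \<open>v i\<close>.\<close>

lemma arc_obtain:
  assumes "g \<in> carrier G" "(\<phi> g v0, y) \<in> A"
  obtains i where "i \<in> {1..K+1}" "y = \<phi> g (v i)"
proof -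
  have y: "y \<in> E" using assms(2) bipartite vertices by blast
  have "(\<phi> (inv g) (\<phi> g v0), \<phi> (inv g) y) \<in> A"
    using arc_image[OF _ assms(2)] assms(1) by simp
  then have "(v0, \<phi> (inv g) y) \<in> A" using assms(1) by (simp add: act_inv)
  then obtain i where "i \<in> {1..K+1}" "\<phi> (inv g) y = v i" by (rule neighbour_obtain)
  moreover have "\<phi> g (\<phi> (inv g) y) = y"
    using act_inv[of "inv g" y] assms(1) y by simp
  ultimately show thesis using that by simp
qed

text \<open>The degree \<open>k + 1\<close> is positive, so \<open>y\<close> has a neighbour; this
  is a left vertex, hence a translate of \<open>v0\<close>, and \<open>arc_obtain\<close>
  applies.\<close>

lemma right_orbit:
  assumes "y \<in> R"
  obtains g i where "g \<in> carrier G" "i \<in> {1..K+1}" "y = \<phi> g (v i)"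
proof -
  have "A `` {y} \<noteq> {}" using right_degree[OF assms] by auto
  then obtain x where "(y, x) \<in> A" by auto
  then have "(x, y) \<in> A" and "x \<in> L" using sym_arcs bipartite assms disjoint by blast+
  then show thesis using that left_orbit arc_obtain by metis
qed

section \<open>The sets \<open>S i\<close> and the bi-Cayley axioms\<close>

lemma mem_S_iff:
  "i \<in> {1..K+1} \<Longrightarrow> s \<in> S i \<longleftrightarrow> s \<in> carrier G \<and> s \<noteq> \<one> \<and> (\<phi> s v0, v i) \<in> A"
  using S_def by simp

lemma S_closed: "i \<in> {1..K+1} \<Longrightarrow> s \<in> S i \<Longrightarrow> s \<in> carrier G"
  by (simp add: mem_S_iff)

text \<open>Both \<open>v i\<close> and \<open>v j\<close> are common neighbours of
  \<open>v0\<close> and \<open>\<phi> s v0\<close>, which differ because \<open>s\<close> is not the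
  identity; without 4-cycles they coincide.\<close>

lemma S_unique:
  assumes i: "i \<in> {1..K+1}" and j: "j \<in> {1..K+1}" and s: "s \<in> S i" "s \<in> S j"
  shows "i = j"
proof -
  have "\<phi> s v0 \<noteq> v0"
    using s(1) left_inj[of s \<one>] i by (auto simp: mem_S_iff act_one)
  then have "v i = v j"
    using no_4_cycle[of v0 "v i" "v j" "\<phi> s v0"] v_arc s i j by (auto simp: mem_S_iff)
  then show ?thesis using v_inj i j by blast
qed

lemma block_index_eq: "i \<in> {1..K+1} \<Longrightarrow> s \<in> S i \<Longrightarrow> block_index K S s = i"
  unfolding block_index_def using S_unique by blast

text \<open>Applying \<open>inv s\<close> to the path from \<open>v0\<close> through
  \<open>v i\<close> to \<open>\<phi> s v0\<close> gives a path from
  \<open>\<phi> (inv s) v0\<close> to \<open>v0\<close>, whose middle vertex is some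
  \<open>v j\<close>. Later arguments use this vertex identity along with the membership.\<close>

lemma inv_mem_S:
  assumes i: "i \<in> {1..K+1}" and s: "s \<in> S i"
  obtains j where "j \<in> {1..K+1}" "inv s \<in> S j" "\<phi> (inv s) (v i) = v j"
proof -
  have sc: "s \<in> carrier G" "s \<noteq> \<one>" "(\<phi> s v0, v i) \<in> A" using s i by (auto simp: mem_S_iff)
  then have "(\<phi> (inv s) (\<phi> s v0), \<phi> (inv s) (v i)) \<in> A" by (blast intro: arc_image inv_closed)
  then obtain j where j: "j \<in> {1..K+1}" "\<phi> (inv s) (v i) = v j"
    using sc by (auto simp: act_inv elim: neighbour_obtain)
  have "(\<phi> (inv s) v0, v j) \<in> A"
    using arc_image[OF _ v_arc[OF i], of "inv s"] sc j by simp
  then have "inv s \<in> S j" using sc j(1) by (simp add: mem_S_iff)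
  with j that show thesis by blast
qed

text \<open>The orbit map at \<open>v0\<close> is injective and matches \<open>S i\<close> with the
  neighbours of \<open>v i\<close> other than \<open>v0\<close>.\<close>

lemma card_S:
  assumes i: "i \<in> {1..K+1}"
  shows "finite (S i) \<and> card (S i) = k"
proof -
  have inj: "inj_on (\<lambda>s. \<phi> s v0) (S i)"
    by (auto simp: inj_on_def dest: left_inj S_closed[OF i])
  have "(\<lambda>s. \<phi> s v0) ` S i = A `` {v i} - {v0}"
  proof (intro equalityI subsetI)
    fix x assume "x \<in> (\<lambda>s. \<phi> s v0) ` S i"
    then obtain s where s: "s \<in> carrier G" "s \<noteq> \<one>" "(\<phi> s v0, v i) \<in> A" "x = \<phi> s v0"
      using i by (auto simp: mem_S_iff)
    then have "x \<noteq> v0" using left_inj[of s \<one>] by (auto simp: act_one)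
    with s show "x \<in> A `` {v i} - {v0}" by (auto intro: sym_arcs)
  next
    fix x assume x: "x \<in> A `` {v i} - {v0}"
    then have "x \<in> L" using bipartite v_right[OF i] disjoint by blast
    then obtain s where s: "s \<in> carrier G" "x = \<phi> s v0" by (rule left_orbit)
    then have "s \<in> S i" using x i by (auto simp: mem_S_iff act_one intro: sym_arcs)
    with s show "x \<in> (\<lambda>s. \<phi> s v0) ` S i" by blast
  qed
  \<comment> \<open>The removed vertex is indeed a neighbour, so the degree \<open>k + 1\<close>
    drops to \<open>k\<close>.\<close>
  moreover have "v0 \<in> A `` {v i}" using v_arc[OF i] by (auto intro: sym_arcs)
  ultimately have "finite ((\<lambda>s. \<phi> s v0) ` S i)" "card ((\<lambda>s. \<phi> s v0) ` S i) = k"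
    using right_degree[OF v_right[OF i]] by auto
  then show ?thesis using inj by (simp add: card_image finite_image_iff)
qed

text \<open>The translate by \<open>inv s\<close> of the arc from \<open>\<phi> t v0\<close> to
  \<open>v i\<close> ends at \<open>v j\<close>, where \<open>j\<close> is the block index of
  \<open>inv s\<close>.\<close>

lemma inv_mult_mem_S:
  assumes i: "i \<in> {1..K+1}" and s: "s \<in> S i" and t: "t \<in> S i" and "s \<noteq> t"
  shows "inv s \<otimes> t \<in> S (block_index K S (inv s))"
proof -
  obtain j where j: "j \<in> {1..K+1}" "inv s \<in> S j" "\<phi> (inv s) (v i) = v j"
    using inv_mem_S[OF i s] .
  have c: "s \<in> carrier G" "t \<in> carrier G" "(\<phi> t v0, v i) \<in> A"
    using s t i by (auto simp: mem_S_iff)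
  have "(\<phi> (inv s \<otimes> t) v0, v j) \<in> A"
    using arc_image[OF _ c(3), of "inv s"] c j(3) by (simp add: act_mult)
  moreover have "inv s \<otimes> t \<noteq> \<one>"
    using c \<open>s \<noteq> t\<close> by (metis inv_closed inv_inv inv_equality inv_unique')
  ultimately have "inv s \<otimes> t \<in> S j" using c j(1) by (simp add: mem_S_iff)
  then show ?thesis using block_index_eq j by simp
qed

lemma bi_cayley: "bi_cayley G K k S"
proof -
  let ?U = "\<Union>i\<in>{1..K+1}. S i"
  have inv_U: "inv s \<in> ?U" if "s \<in> ?U" for s
    using that inv_mem_S by (metis UN_iff)
  have "(\<lambda>s. inv s) ` ?U = ?U"
  proof (intro equalityI subsetI)
    \<comment> \<open>Surjectivity: \<open>s\<close> is the inverse of its own inverse, which lies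
      in the union as well.\<close>
    fix s assume s: "s \<in> ?U"
    then have "s \<in> carrier G" using S_closed by blast
    then have "s = inv (inv s)" by simp
    with inv_U[OF s] show "s \<in> (\<lambda>s. inv s) ` ?U" by blast
  qed (use inv_U in blast)
  moreover have "\<one> \<notin> ?U" by (auto simp: mem_S_iff)
  moreover have "disjoint_family_on S {1..K+1}"
    unfolding disjoint_family_on_def using S_unique by blast
  moreover have "S i \<subseteq> carrier G" if "i \<in> {1..K+1}" for i
    using S_closed[OF that] by blast
  ultimately show ?thesis
    unfolding bi_cayley_def Let_def
    by (intro conjI ballI) (assumption | simp only: is_group card_S | metis inv_mult_mem_S)+
qed

section \<open>Equivalence classes as right vertices\<close>

lemma cayb_rel_iff:
  assumes g: "g \<in> carrier G" "i \<in> {1..K+1}" and h: "h \<in> carrier G" "j \<in> {1..K+1}"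
  shows "((g, i), (h, j)) \<in> cayb_rel G K S \<longleftrightarrow> \<phi> g (v i) = \<phi> h (v j)"
proof -
  have inv_quot: "inv (inv a \<otimes> b) = inv b \<otimes> a"
    if "a \<in> carrier G" "b \<in> carrier G" for a b
    using that by (simp add: inv_mult_group)
  \<comment> \<open>Serves both orders of the two pairs: \<open>inv a \<otimes> b\<close> sends
    \<open>v m\<close> to \<open>v l\<close>, so it carries the arc from \<open>v0\<close> to
    \<open>v m\<close> to one ending at \<open>v l\<close>.\<close>
  have mem: "inv a \<otimes> b \<in> S l"
    if "a \<in> carrier G" "b \<in> carrier G" "l \<in> {1..K+1}" "m \<in> {1..K+1}" "a \<noteq> b"
      "\<phi> a (v l) = \<phi> b (v m)" for a b l m
  proof -
    have "\<phi> (inv a \<otimes> b) (v m) = v l" using that act_eq_iff v_in by simp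
    then have "(\<phi> (inv a \<otimes> b) v0, v l) \<in> A"
      using arc_image[OF _ v_arc[OF that(4)], of "inv a \<otimes> b"] that by simp
    moreover have "inv a \<otimes> b \<noteq> \<one>"
      using that by (metis inv_closed inv_inv inv_equality inv_unique')
    ultimately show ?thesis using that by (simp add: mem_S_iff)
  qed
  show ?thesis
  proof
    assume "((g, i), (h, j)) \<in> cayb_rel G K S"
    then consider "g = h" "i = j" | "inv g \<otimes> h \<in> S i" "inv h \<otimes> g \<in> S j"
      by (auto simp: cayb_rel_def)
    then show "\<phi> g (v i) = \<phi> h (v j)"
    proof cases
      case 2
      \<comment> \<open>The inverse of \<open>inv g \<otimes> h\<close> is
        \<open>inv h \<otimes> g\<close>, which therefore lies in both \<open>S l\<close> and
        \<open>S j\<close>; disjointness of the blocks gives \<open>l = j\<close>.\<close>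
      obtain l where l: "l \<in> {1..K+1}" "inv (inv g \<otimes> h) \<in> S l"
        "\<phi> (inv (inv g \<otimes> h)) (v i) = v l"
        using inv_mem_S[OF g(2) 2(1)] .
      with 2 inv_quot g h have "l = j" using S_unique by metis
      with l inv_quot g h have "\<phi> (inv h \<otimes> g) (v i) = v j" by simp
      then show ?thesis using act_eq_iff[of h g "v j" "v i"] g h v_in by simp
    qed simp
  next
    assume eq: "\<phi> g (v i) = \<phi> h (v j)"
    show "((g, i), (h, j)) \<in> cayb_rel G K S"
    proof (cases "g = h")
      case True
      \<comment> \<open>Cancelling the group element leaves equal neighbours of \<open>v0\<close>,
        hence equal indices, and the equality clause of the relation applies.\<close>
      then have "v i = v j" using act_inv eq g h v_in by metis
      then show ?thesis using True g h v_inj by (auto simp: cayb_rel_def)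
    next
      case False
      then show ?thesis using mem[of g h i j] mem[of h g j i] eq g h by (simp add: cayb_rel_def)
    qed
  qed
qed

text \<open>From left to right this makes the map from classes to right vertices well defined, from
  right to left injective.\<close>

lemma cayb_class_eq_iff:
  assumes "g \<in> carrier G" "i \<in> {1..K+1}" "h \<in> carrier G" "j \<in> {1..K+1}"
  shows "cayb_class G K S g i = cayb_class G K S h j \<longleftrightarrow> \<phi> g (v i) = \<phi> h (v j)"
  unfolding cayb_class_def
  using eq_equiv_class_iff[OF equiv_cayb_rel[OF bi_cayley], of "(g, i)" "(h, j)"]
    cayb_rel_iff assms by auto

text \<open>On a class the representative is irrelevant by \<open>cayb_class_eq_iff\<close>.\<close>

definition cayb_map :: "'g + ('g \<times> nat) set \<Rightarrow> 'v" where
  "cayb_map = case_sum (\<lambda>g. \<phi> g v0) (\<lambda>C. let (g, i) = SOME p. p \<in> C in \<phi> g (v i))"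

lemma cayb_map_Inl [simp]: "cayb_map (Inl g) = \<phi> g v0"
  by (simp add: cayb_map_def)

lemma cayb_map_class:
  assumes "g \<in> carrier G" "i \<in> {1..K+1}"
  shows "cayb_map (Inr (cayb_class G K S g i)) = \<phi> g (v i)"
proof -
  let ?C = "cayb_class G K S g i"
  obtain h j where hj: "(SOME p. p \<in> ?C) = (h, j)" by fastforce
  \<comment> \<open>By reflexivity the class is nonempty, so the choice operator returns a member,
    possibly a different representative.\<close>
  have "(g, i) \<in> ?C" using assms by (simp add: cayb_class_def cayb_rel_iff)
  then have "(h, j) \<in> ?C" using hj by (metis someI)
  then have "((g, i), (h, j)) \<in> cayb_rel G K S" by (simp add: cayb_class_def)
  moreover from this have "h \<in> carrier G" "j \<in> {1..K+1}" by (auto simp: cayb_rel_def)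
  ultimately have "\<phi> g (v i) = \<phi> h (v j)" using cayb_rel_iff assms by blast
  then show ?thesis using hj by (simp add: cayb_map_def)
qed

section \<open>Vertices and arcs of the Cayley bigraph\<close>

lemma quotient_cayb_rel:
  "(carrier G \<times> {1..K+1}) // cayb_rel G K S = (\<lambda>(g, i). cayb_class G K S g i) ` (carrier G \<times> {1..K+1})"
  unfolding quotient_def cayb_class_def by blast

lemma vertex_CayB_iff:
  "x \<in> pverts (CayB G K S) \<longleftrightarrow> (\<exists>g\<in>carrier G. x = Inl g) \<or>
    (\<exists>g\<in>carrier G. \<exists>i\<in>{1..K+1}. x = Inr (cayb_class G K S g i))"
  unfolding CayB_def quotient_cayb_rel by (force simp del: atLeastAtMost_iff)

lemma pair_wf_digraph_CayB: "pair_wf_digraph (CayB G K S)"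
proof
  fix e assume "e \<in> parcs (CayB G K S)"
  then obtain g i where "g \<in> carrier G" "i \<in> {1..K+1}"
    "e = (Inl g, Inr (cayb_class G K S g i)) \<or> e = (Inr (cayb_class G K S g i), Inl g)"
    unfolding CayB_def by auto
  then show "fst e \<in> pverts (CayB G K S)" "snd e \<in> pverts (CayB G K S)"
    unfolding vertex_CayB_iff by (metis fst_conv snd_conv)+
qed

text \<open>By definition the arcs at \<open>Inl g\<close> lead to classes of pairs
  \<open>(g, j)\<close>, while the class here has an arbitrary representative \<open>(h, i)\<close>.
  \<open>arc_obtain\<close> finds \<open>j\<close> from an arc in \<open>A\<close>, and
  \<open>cayb_class_eq_iff\<close> changes the representative.\<close>

lemma arc_CayB_iff:
  assumes "h \<in> carrier G" "i \<in> {1..K+1}"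
  shows "(Inl g, Inr (cayb_class G K S h i)) \<in> parcs (CayB G K S)
    \<longleftrightarrow> g \<in> carrier G \<and> (\<phi> g v0, \<phi> h (v i)) \<in> A" (is "?l \<longleftrightarrow> ?r")
proof
  assume ?l
  then obtain j where j: "g \<in> carrier G" "j \<in> {1..K+1}"
    "cayb_class G K S h i = cayb_class G K S g j"
    by (auto simp: CayB_def)
  then have "\<phi> h (v i) = \<phi> g (v j)" using cayb_class_eq_iff assms by blast
  then show ?r using j arc_image v_arc by simp
next
  assume r: ?r
  then obtain j where "j \<in> {1..K+1}" "\<phi> h (v i) = \<phi> g (v j)" by (auto elim: arc_obtain)
  then have "j \<in> {1..K+1}" "cayb_class G K S h i = cayb_class G K S g j"
    using cayb_class_eq_iff assms r by blast+
  then show ?l using r by (auto simp: CayB_def)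
qed

lemma arc_CayB_cases:
  assumes "(x, y) \<in> parcs (CayB G K S)"
  shows "\<not> (isl x \<longleftrightarrow> isl y)" "(y, x) \<in> parcs (CayB G K S)"
  using assms by (auto simp: CayB_def)

section \<open>The isomorphism onto the given graph\<close>

lemma cayb_map_image: "cayb_map ` pverts (CayB G K S) = E"
proof (intro equalityI subsetI)
  fix y assume "y \<in> cayb_map ` pverts (CayB G K S)"
  then obtain x where x: "x \<in> pverts (CayB G K S)" "y = cayb_map x" by blast
  from x(1) consider g where "g \<in> carrier G" "x = Inl g"
    | g i where "g \<in> carrier G" "i \<in> {1..K+1}" "x = Inr (cayb_class G K S g i)"
    unfolding vertex_CayB_iff by blast
  then show "y \<in> E"
    using x(2) left_image base right_image vertices by cases (auto simp only: cayb_map_class cayb_map_Inl)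
next
  fix y assume "y \<in> E"
  then consider "y \<in> L" | "y \<in> R" using vertices by auto
  then show "y \<in> cayb_map ` pverts (CayB G K S)"
  proof cases
    case 1
    then obtain g where "g \<in> carrier G" "y = cayb_map (Inl g)"
      by (metis left_orbit cayb_map_Inl)
    then show ?thesis using vertex_CayB_iff by blast
  next
    case 2
    then obtain g i where "g \<in> carrier G" "i \<in> {1..K+1}" "y = \<phi> g (v i)"
      by (rule right_orbit)
    then show ?thesis using cayb_map_class vertex_CayB_iff by (metis image_eqI)
  qed
qed

text \<open>Since \<open>L\<close> and \<open>R\<close> are disjoint, the image determines the side,
  so injectivity and adjacency can be settled by cases on sides.\<close>

lemma cayb_map_side:
  assumes "x \<in> pverts (CayB G K S)"
  shows "isl x \<longleftrightarrow> cayb_map x \<in> L" "\<not> isl x \<longleftrightarrow> cayb_map x \<in> R"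
proof -
  from assms consider g where "g \<in> carrier G" "x = Inl g"
    | g i where "g \<in> carrier G" "i \<in> {1..K+1}" "x = Inr (cayb_class G K S g i)"
    unfolding vertex_CayB_iff by blast
  then have "isl x \<and> cayb_map x \<in> L \<or> \<not> isl x \<and> cayb_map x \<in> R"
  proof cases
    case 1
    then show ?thesis using left_image base by simp
  next
    case 2
    then show ?thesis using right_image cayb_map_class by simp
  qed
  then show "isl x \<longleftrightarrow> cayb_map x \<in> L" "\<not> isl x \<longleftrightarrow> cayb_map x \<in> R"
    using disjoint by auto
qed

lemma vertex_CayB_inl:
  assumes "x \<in> pverts (CayB G K S)" "isl x"
  obtains g where "g \<in> carrier G" "x = Inl g"
  using assms unfolding vertex_CayB_iff by fastforce

lemma vertex_CayB_inr:
  assumes "x \<in> pverts (CayB G K S)" "\<not> isl x"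
  obtains g i where "g \<in> carrier G" "i \<in> {1..K+1}" "x = Inr (cayb_class G K S g i)"
  using assms unfolding vertex_CayB_iff by fastforce

text \<open>Equal images lie on the same side; there \<open>left_inj\<close> separates group
  elements and \<open>cayb_class_eq_iff\<close> separates classes.\<close>

lemma inj_cayb_map: "inj_on cayb_map (pverts (CayB G K S))"
proof (rule inj_onI)
  fix x y
  assume x: "x \<in> pverts (CayB G K S)" and y: "y \<in> pverts (CayB G K S)"
    and eq: "cayb_map x = cayb_map y"
  then have side: "isl x \<longleftrightarrow> isl y" using cayb_map_side by metis
  show "x = y"
  proof (cases "isl x")
    case True
    obtain g where g: "g \<in> carrier G" "x = Inl g" using x True by (rule vertex_CayB_inl)
    obtain h where h: "h \<in> carrier G" "y = Inl h"
      using y True side by (metis vertex_CayB_inl)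
    show ?thesis using g h eq left_inj by simp
  next
    case False
    obtain g i where g: "g \<in> carrier G" "i \<in> {1..K+1}" "x = Inr (cayb_class G K S g i)"
      using x False by (rule vertex_CayB_inr)
    obtain h j where h: "h \<in> carrier G" "j \<in> {1..K+1}" "y = Inr (cayb_class G K S h j)"
      using y False side by (metis vertex_CayB_inr)
    have "\<phi> g (v i) = \<phi> h (v j)" using eq g h cayb_map_class by metis
    then show ?thesis using g h cayb_class_eq_iff by metis
  qed
qed

lemma bij_cayb_map: "bij_betw cayb_map (pverts (CayB G K S)) E"
  using inj_cayb_map cayb_map_image by (rule bij_betw_imageI)

text \<open>Both arc relations are symmetric and join only opposite sides, so the pairs from left to
  right decide everything.\<close>

lemma cayb_map_arc_iff:
  assumes x: "x \<in> pverts (CayB G K S)" and y: "y \<in> pverts (CayB G K S)"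
  shows "(x, y) \<in> parcs (CayB G K S) \<longleftrightarrow> (cayb_map x, cayb_map y) \<in> A"
proof -
  have mixed: "(a, b) \<in> parcs (CayB G K S) \<longleftrightarrow> (cayb_map a, cayb_map b) \<in> A"
    if a: "a \<in> pverts (CayB G K S)" "isl a" and b: "b \<in> pverts (CayB G K S)" "\<not> isl b" for a b
  proof -
    obtain g where g: "g \<in> carrier G" "a = Inl g" using a by (rule vertex_CayB_inl)
    obtain h i where h: "h \<in> carrier G" "i \<in> {1..K+1}" "b = Inr (cayb_class G K S h i)"
      using b by (rule vertex_CayB_inr)
    show ?thesis
      unfolding g(2) h(3) arc_CayB_iff[OF h(1,2)] cayb_map_class[OF h(1,2)] using g(1) by simp
  qed
  show ?thesis
  proof (cases "isl x \<longleftrightarrow> isl y")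
    case True
    then show ?thesis
      using arc_CayB_cases(1) cayb_map_side[OF x] cayb_map_side[OF y] bipartite disjoint by blast
  next
    case False
    then show ?thesis
      using mixed[of x y] mixed[of y x] x y arc_CayB_cases(2) sym_arcs by blast
  qed
qed

end

section \<open>Application to the biregular tree\<close>

theorem theorem2p9:
  fixes \<Lambda> :: "('g, 'm) monoid_scheme"
    and T :: "'v pair_pre_digraph"
    and L\<^sub>T R\<^sub>T :: "'v set"
    and \<phi> :: "'g \<Rightarrow> 'v \<Rightarrow> 'v"
    and K k :: nat
    and v0 :: 'v
    and v :: "nat \<Rightarrow> 'v"
    and S :: "nat \<Rightarrow> 'g set"
  assumes "k \<le> K"
    and "biregular_tree (K + 1) (k + 1) L\<^sub>T R\<^sub>T T"
    and "group \<Lambda>"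
    and "graph_action \<Lambda> T \<phi>"
    and "simply_transitive_on \<Lambda> \<phi> L\<^sub>T"
    and "v0 \<in> L\<^sub>T"
    and "bij_betw v {1..K+1} {w. (v0, w) \<in> parcs T}"
    and "\<And>i. i \<in> {1..K+1} \<Longrightarrow>
           S i = {s \<in> carrier \<Lambda>. s \<noteq> \<one>\<^bsub>\<Lambda>\<^esub> \<and> graph_dist T (\<phi> s v0) (v i) = 1}"
  shows "bi_cayley \<Lambda> K k S \<and>
    (\<exists>f. graph_isomorphism f (CayB \<Lambda> K S) T \<and>
       (\<forall>g\<in>carrier \<Lambda>. f (Inl g) = \<phi> g v0) \<and>
       (\<forall>g\<in>carrier \<Lambda>. \<forall>i\<in>{1..K+1}. f (Inr (cayb_class \<Lambda> K S g i)) = \<phi> g (v i)))"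
proof -
  have tree: "undirected_tree T"
    and verts: "pverts T = L\<^sub>T \<union> R\<^sub>T" "L\<^sub>T \<inter> R\<^sub>T = {}"
    and arcs: "parcs T \<subseteq> L\<^sub>T \<times> R\<^sub>T \<union> R\<^sub>T \<times> L\<^sub>T"
    using assms(2) by (auto simp: biregular_tree_def)
  have deg: "finite (out_arcs (with_proj T) y)" "out_degree (with_proj T) y = k + 1"
    if "y \<in> R\<^sub>T" for y
    using assms(2) that by (auto simp: biregular_tree_def)
  interpret T: pair_bidirected_digraph T using tree by (simp add: undirected_tree_def)
  have wf: "pair_wf_digraph T" by unfold_locales
  have iso: "graph_isomorphism (\<phi> g) T T" if "g \<in> carrier \<Lambda>" for g
    using assms(4) that by (auto simp: graph_action_def)
  have act: "group_action \<Lambda> (pverts T) \<phi>" using assms(4) by (simp add: graph_action_def)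
  \<comment> \<open>Arcs are pairs, so those leaving \<open>y\<close> correspond to its neighbours
    and the out-degree counts neighbours.\<close>
  have out: "out_arcs (with_proj T) y = Pair y ` (parcs T `` {y})" for y
    by (auto simp: out_arcs_def)
  have right: "finite (parcs T `` {y}) \<and> card (parcs T `` {y}) = k + 1" if "y \<in> R\<^sub>T" for y
    using deg[OF that] unfolding out_degree_def out
    by (simp add: card_image inj_on_def finite_image_iff)
  have inv: "(\<phi> g x, \<phi> g y) \<in> parcs T" if "g \<in> carrier \<Lambda>" "(x, y) \<in> parcs T" for g x y
    using iso[OF that(1)] graph_isomorphism_iff[OF wf wf, of "\<phi> g"] that(2) T.wellformed' by blast
  have nbr: "parcs T `` {v0} = {w. (v0, w) \<in> parcs T}" by auto
  have S: "S i = {s \<in> carrier \<Lambda>. s \<noteq> \<one>\<^bsub>\<Lambda>\<^esub> \<and> (\<phi> s v0, v i) \<in> parcs T}"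
    if i: "i \<in> {1..K+1}" for i
  proof -
    have "(v0, v i) \<in> parcs T" using bij_betw_apply[OF assms(7) i] by simp
    then have "v i \<in> R\<^sub>T" using arcs assms(6) verts by blast
    moreover have "\<phi> s v0 \<in> L\<^sub>T" if "s \<in> carrier \<Lambda>" for s
      using assms(5,6) that unfolding simply_transitive_on_def by blast
    \<comment> \<open>Reading distance 1 as an arc requires distinct ends; these two lie on opposite
      sides of the bipartition.\<close>
    ultimately have "\<phi> s v0 \<noteq> v i" if "s \<in> carrier \<Lambda>" for s using that verts(2) by (metis disjoint_iff)
    then show ?thesis using assms(8)[OF i] graph_dist_eq_1_iff[OF wf] by auto
  qed
  have sym: "(y, x) \<in> parcs T" if "(x, y) \<in> parcs T" for x y
    using T.pair_sym_arcs that by (auto simp: symmetric_def dest: symD)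
  interpret simply_transitive_bigraph \<Lambda> "pverts T" \<phi> "parcs T" L\<^sub>T R\<^sub>T K k v0 v S
    by (rule simply_transitive_bigraph.intro[OF act], rule simply_transitive_bigraph_axioms.intro)
      (fact verts arcs right assms(5,6) inv sym S assms(7)[folded nbr]
        undirected_tree_no_4_cycle[OF tree])+
  have "graph_isomorphism cayb_map (CayB \<Lambda> K S) T"
    using graph_isomorphism_iff[OF pair_wf_digraph_CayB wf] bij_cayb_map cayb_map_arc_iff by blast
  then show ?thesis using bi_cayley cayb_map_class by auto
qed

end
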